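(* Let $f$ be a nilpotent $k$-file placement on $[n]$ and let $\sigma=\sigma_f$ be the corresponding labeled rooted forest. For each $i=1,\dots,n-1$, the underlying unlabeled rooted forest of $(i,i+1)\cdot\sigma$ is equal (isomorphic) to that of $\sigma$, where $(i,i+1)\in S_n$ is the simple transposition. Moreover, if $o$ is a fixed unlabeled rooted forest, then $S_n$ acts transitively on the set of elements $\sigma\in\mathcal{C}_{k,n}$ whose underlying unlabeled rooted forest is equal to $o$.
   Context: Write $[n]=\{1,\dots,n\}$. A $k$-file placement on $[n]$ is a function $f:A\to[n]$ with $A\subseteq[n]$, $|A|=k$; it is nilpotent if the digraph on $[n]$ with edges $i\to f(i)$ ($i\in A$) has no directed cycle (including loops). $\mathcal{C}_{k,n}$ is the set of nilpotent $k$-file placements. A nilpotent file placement $f$ is identified with the labeled rooted forest $\sigma_f$ on vertex set $[n]$ in which $f(i)$ is the parent of $i$ for $i\in A$ and the elements of $[n]\setminus A$ are the roots. The symmetric group $S_n$ acts by conjugation, $w\cdot f=w\circ f\circ w^{-1}$ (with domain $w(A)$). *)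

theory Defs
  imports "HOL-Algebra.Group_Action" "HOL-Algebra.Sym_Groups"
begin

text \<open>
  A \<open>k\<close>-file placement \<open>f : A \<rightarrow> [n]\<close> is a partial map whose domain is \<open>A\<close>.
\<close>

definition file_placement :: "nat \<Rightarrow> nat \<Rightarrow> (nat \<rightharpoonup> nat) \<Rightarrow> bool" where
  "file_placement k n f \<longleftrightarrow> dom f \<subseteq> {1..n} \<and> ran f \<subseteq> {1..n} \<and> card (dom f) = k"

definition edges :: "(nat \<rightharpoonup> nat) \<Rightarrow> (nat \<times> nat) set" where
  "edges f = {(i, j). f i = Some j}"

definition nilpotent_placements :: "nat \<Rightarrow> nat \<Rightarrow> (nat \<rightharpoonup> nat) set" where
  "nilpotent_placements k n = {f. file_placement k n f \<and> acyclic (edges f)}"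

text \<open>
  The conjugate \<open>w \<circ> f \<circ> w\<inverse>\<close>; as a partial map it has domain \<open>w ` dom f\<close>.
\<close>

definition conj_act :: "(nat \<Rightarrow> nat) \<Rightarrow> (nat \<rightharpoonup> nat) \<Rightarrow> (nat \<rightharpoonup> nat)" where
  "conj_act w f = map_option w \<circ> f \<circ> inv_into UNIV w"

text \<open>
  A labeled rooted forest is a pair of a finite vertex set and the set of edges directed from
  child to parent; the roots are the vertices without outgoing edge.
\<close>

type_synonym forest = "nat set \<times> (nat \<times> nat) set"

definition rooted_forest :: "forest \<Rightarrow> bool" where
  "rooted_forest \<sigma> \<longleftrightarrow> (case \<sigma> of (V, E) \<Rightarrow>
     finite V \<and> E \<subseteq> V \<times> V \<and> single_valued E \<and> acyclic E)"

definition forest_of :: "nat \<Rightarrow> (nat \<rightharpoonup> nat) \<Rightarrow> forest" where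
  "forest_of n f = ({1..n}, edges f)"

text \<open>
  Isomorphisms respect the parent relation in both directions, hence also the roots.
\<close>

definition forest_iso :: "(forest \<times> forest) set" where
  "forest_iso = {((V, E), (V', E')). rooted_forest (V, E) \<and> rooted_forest (V', E') \<and>
     (\<exists>\<phi>. bij_betw \<phi> V V' \<and> (\<forall>u\<in>V. \<forall>v\<in>V. (u, v) \<in> E \<longleftrightarrow> (\<phi> u, \<phi> v) \<in> E'))}"

text \<open>
  An unlabeled rooted forest is an isomorphism class of labeled rooted forests. Every finite
  forest has a labeling by natural numbers, so labels in \<open>nat\<close> lose no isomorphism type.
\<close>

definition unlabeled_forests :: "forest set set" where
  "unlabeled_forests = {\<sigma>. rooted_forest \<sigma>} // forest_iso"

definition underlying :: "forest \<Rightarrow> forest set" where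
  "underlying \<sigma> = forest_iso `` {\<sigma>}"

definition placements_with_shape :: "nat \<Rightarrow> nat \<Rightarrow> forest set \<Rightarrow> (nat \<rightharpoonup> nat) set" where
  "placements_with_shape k n S = {f \<in> nilpotent_placements k n. underlying (forest_of n f) = S}"

end

(* Relabelling by a permutation w is an isomorphism from the forest of f to that of the
   conjugate of f, so conjugation preserves shapes. Conversely, an isomorphism between two
   forests on {1..n}, extended by the identity outside {1..n}, is a permutation w; because w
   respects the parent relation, it conjugates one placement into the other. *)
theory Submission
  imports Defs
begin

lemma conj_act_apply: "inj w \<Longrightarrow> conj_act w f (w i) = map_option w (f i)"
  by (simp add: conj_act_def)

text \<open>A bijective \<open>w\<close> reaches every point as some \<open>w i\<close>, so values
  at these points determine the conjugate and the inverse in its definition drops out. The action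
  laws are proved in this form.\<close>

lemma conj_act_eqI:
  assumes "bij w" and "\<And>i. g (w i) = map_option w (f i)"
  shows "conj_act w f = g"
proof
  fix j
  obtain i where "j = w i"
    using assms(1) by (meson bij_pointE)
  then show "conj_act w f j = g j"
    using assms by (simp add: conj_act_apply bij_is_inj)
qed

lemma conj_act_id: "conj_act id f = f"
  by (rule conj_act_eqI) (simp_all add: option.map_id)

lemma conj_act_comp:
  assumes "bij v" "bij w"
  shows "conj_act (v \<circ> w) f = conj_act v (conj_act w f)"
  using assms by (intro conj_act_eqI)
    (simp_all add: bij_comp conj_act_apply bij_is_inj option.map_comp)

lemma conj_act_edges_iff:
  assumes "inj w"
  shows "(w i, w j) \<in> edges (conj_act w f) \<longleftrightarrow> (i, j) \<in> edges f"
  using assms by (auto simp: edges_def conj_act_apply inj_eq)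

text \<open>Conjugation relabels both ends of each edge. Domain, range and acyclicity of the
  conjugate can thus be read off from an image of the old edge set.\<close>

lemma edges_conj_act:
  assumes "bij w"
  shows "edges (conj_act w f) = map_prod w w ` edges f"
proof -
  have "(a, b) \<in> edges (conj_act w f) \<longleftrightarrow> (a, b) \<in> map_prod w w ` edges f" for a b
  proof -
    obtain i j where "a = w i" "b = w j"
      using assms by (meson bij_pointE)
    then show ?thesis
      using assms by (auto simp: conj_act_edges_iff bij_is_inj inj_eq)
  qed
  then show ?thesis
    by (simp add: set_eq_iff split_paired_all)
qed

lemma dom_eq_edges: "dom f = fst ` edges f"
  by (force simp: edges_def dom_def)

lemma ran_eq_edges: "ran f = snd ` edges f"
  by (force simp: edges_def ran_def)

text \<open>A path in the image lifts to a path in \<open>r\<close>: by injectivity, consecutive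
  edges that meet in the image already meet at a common vertex before relabelling. A cycle therefore
  lifts to a cycle.\<close>

lemma acyclic_map_prod_image:
  assumes "inj w" "acyclic r"
  shows "acyclic (map_prod w w ` r)"
proof -
  have "\<exists>i j. x = w i \<and> y = w j \<and> (i, j) \<in> r\<^sup>+" if "(x, y) \<in> (map_prod w w ` r)\<^sup>+" for x y
    using that
  proof induction
    case (base y)
    then show ?case by auto
  next
    case (step y z)
    then show ?case
      using assms(1) by (auto simp: inj_eq intro: trancl_into_trancl)
  qed
  then show ?thesis
    using assms unfolding acyclic_def inj_eq by (metis injD)
qed

lemma conj_act_nilpotent:
  assumes w: "w permutes {1..n}" and f: "f \<in> nilpotent_placements k n"
  shows "conj_act w f \<in> nilpotent_placements k n"
proof -
  note bij = permutes_bij[OF w]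
  have dom: "dom (conj_act w f) = w ` dom f" and ran: "ran (conj_act w f) = w ` ran f"
    by (simp_all add: dom_eq_edges ran_eq_edges edges_conj_act[OF bij] image_image)
  have "acyclic (edges (conj_act w f))"
    using f by (simp add: nilpotent_placements_def edges_conj_act bij acyclic_map_prod_image bij_is_inj)
  moreover have "card (w ` dom f) = card (dom f)"
    by (rule card_image) (rule permutes_inj_on[OF w])
  ultimately show ?thesis
    using f image_mono[of "dom f" "{1..n}" w] image_mono[of "ran f" "{1..n}" w]
    by (simp add: nilpotent_placements_def file_placement_def dom ran permutes_image[OF w]
        del: One_nat_def)
qed

lemma rooted_forest_forest_of:
  assumes "f \<in> nilpotent_placements k n"
  shows "rooted_forest (forest_of n f)"
  using assms
  by (auto simp: rooted_forest_def forest_of_def nilpotent_placements_def file_placement_def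
      edges_def single_valued_def dom_def ran_def)

lemma forest_iso_sym: "sym forest_iso"
proof (rule symI)
  fix \<sigma> \<tau> assume a: "(\<sigma>, \<tau>) \<in> forest_iso"
  obtain V E V' E' where eq: "\<sigma> = (V, E)" "\<tau> = (V', E')" by fastforce
  from a obtain \<phi> where \<phi>: "bij_betw \<phi> V V'"
      "\<And>u v. u \<in> V \<Longrightarrow> v \<in> V \<Longrightarrow> (u, v) \<in> E \<longleftrightarrow> (\<phi> u, \<phi> v) \<in> E'"
    and forests: "rooted_forest (V, E)" "rooted_forest (V', E')"
    unfolding eq forest_iso_def by auto
  have "(u, v) \<in> E' \<longleftrightarrow> (inv_into V \<phi> u, inv_into V \<phi> v) \<in> E" if "u \<in> V'" "v \<in> V'" for u v
    using \<phi>(2)[of "inv_into V \<phi> u" "inv_into V \<phi> v"] that \<phi>(1)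
    by (metis bij_betw_def bij_betw_inv_into_right inv_into_into)
  then show "(\<tau>, \<sigma>) \<in> forest_iso"
    using bij_betw_inv_into[OF \<phi>(1)] forests unfolding eq forest_iso_def by auto
qed

lemma forest_iso_trans: "trans forest_iso"
proof (rule transI)
  fix \<rho> \<sigma> \<tau> assume a: "(\<rho>, \<sigma>) \<in> forest_iso" "(\<sigma>, \<tau>) \<in> forest_iso"
  obtain V E V' E' V'' E'' where eq: "\<rho> = (V, E)" "\<sigma> = (V', E')" "\<tau> = (V'', E'')"
    by (metis surj_pair)
  from a(1) obtain \<phi> where \<phi>: "bij_betw \<phi> V V'"
      "\<And>u v. u \<in> V \<Longrightarrow> v \<in> V \<Longrightarrow> (u, v) \<in> E \<longleftrightarrow> (\<phi> u, \<phi> v) \<in> E'"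
    and forests: "rooted_forest (V, E)"
    unfolding eq forest_iso_def by auto
  from a(2) obtain \<psi> where \<psi>: "bij_betw \<psi> V' V''"
      "\<And>u v. u \<in> V' \<Longrightarrow> v \<in> V' \<Longrightarrow> (u, v) \<in> E' \<longleftrightarrow> (\<psi> u, \<psi> v) \<in> E''"
    and forests'': "rooted_forest (V'', E'')"
    unfolding eq forest_iso_def by auto
  have "(u, v) \<in> E \<longleftrightarrow> ((\<psi> \<circ> \<phi>) u, (\<psi> \<circ> \<phi>) v) \<in> E''" if "u \<in> V" "v \<in> V" for u v
    using that \<phi>(2)[OF that] \<psi>(2)[of "\<phi> u" "\<phi> v"] bij_betwE[OF \<phi>(1)] by simp
  then show "(\<rho>, \<tau>) \<in> forest_iso"
    using bij_betw_trans[OF \<phi>(1) \<psi>(1)] forests forests'' unfolding eq forest_iso_def by blast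
qed

text \<open>The carrier consists of the rooted forests because the relation demands this property of
  both components, so reflexivity holds exactly there.\<close>

lemma equiv_forest_iso: "equiv {\<sigma>. rooted_forest \<sigma>} forest_iso"
proof (rule equivI)
  have "(\<sigma>, \<sigma>) \<in> forest_iso" if "rooted_forest \<sigma>" for \<sigma>
    using that bij_betw_id unfolding forest_iso_def by (cases \<sigma>) fastforce
  then show "refl_on {\<sigma>. rooted_forest \<sigma>} forest_iso"
    by (auto simp: refl_on_def)
  show "forest_iso \<subseteq> {\<sigma>. rooted_forest \<sigma>} \<times> {\<sigma>. rooted_forest \<sigma>}"
    unfolding forest_iso_def by auto
qed (fact forest_iso_sym forest_iso_trans)+

lemma forest_of_conj_act_iso:
  assumes w: "w permutes {1..n}" and f: "f \<in> nilpotent_placements k n"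
  shows "(forest_of n f, forest_of n (conj_act w f)) \<in> forest_iso"
  using rooted_forest_forest_of[OF f] rooted_forest_forest_of[OF conj_act_nilpotent[OF w f]]
    permutes_imp_bij[OF w] conj_act_edges_iff[OF permutes_inj[OF w]]
  unfolding forest_of_def forest_iso_def by blast

text \<open>The isomorphism is \<open>w\<close> itself. All permutations are covered, not just
  adjacent transpositions, since the action on a fixed shape uses the whole symmetric group.\<close>

lemma underlying_conj_act:
  assumes "w permutes {1..n}" and "f \<in> nilpotent_placements k n"
  shows "underlying (forest_of n (conj_act w f)) = underlying (forest_of n f)"
  unfolding underlying_def
  using equiv_class_eq[OF equiv_forest_iso forest_of_conj_act_iso[OF assms]] by simp

lemma conj_act_with_shape:
  assumes "w permutes {1..n}" and "f \<in> placements_with_shape k n S"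
  shows "conj_act w f \<in> placements_with_shape k n S"
  using assms conj_act_nilpotent underlying_conj_act
  unfolding placements_with_shape_def by blast

lemma ex_conj_act_eq:
  assumes f: "f \<in> nilpotent_placements k n" and g: "g \<in> nilpotent_placements l n"
    and "underlying (forest_of n f) = underlying (forest_of n g)"
  shows "\<exists>w. w permutes {1..n} \<and> conj_act w f = g"
proof -
  \<comment> \<open>Equal classes yield related elements only within the carrier: anything that is
    not a rooted forest has the empty class.\<close>
  have "(forest_of n f, forest_of n g) \<in> forest_iso"
    using assms(3) eq_equiv_class[OF _ equiv_forest_iso] rooted_forest_forest_of[OF g]
    unfolding underlying_def by simp
  then obtain \<phi> where \<phi>: "bij_betw \<phi> {1..n} {1..n}"
      "\<And>i j. i \<in> {1..n} \<Longrightarrow> j \<in> {1..n} \<Longrightarrow> (i, j) \<in> edges f \<longleftrightarrow> (\<phi> i, \<phi> j) \<in> edges g"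
    unfolding forest_iso_def forest_of_def by blast
  define w where "w i = (if i \<in> {1..n} then \<phi> i else i)" for i
  have w: "w permutes {1..n}"
  proof (rule bij_imp_permutes)
    show "bij_betw w {1..n} {1..n}"
      using \<phi>(1) by (subst bij_betw_cong[of _ w \<phi>]) (simp_all add: w_def)
  qed (simp only: w_def if_False)
  have edges_sub: "edges h \<subseteq> {1..n} \<times> {1..n}" if "h \<in> nilpotent_placements m n" for h m
    using rooted_forest_forest_of[OF that] by (simp add: rooted_forest_def forest_of_def)
  \<comment> \<open>The isomorphism compares edges only between vertices in \<open>{1..n}\<close>.
    If \<open>i\<close> or \<open>j\<close> lies outside, so does its image under \<open>w\<close>,
    and then neither side is an edge.\<close>
  have edge: "f i = Some j \<longleftrightarrow> g (w i) = Some (w j)" for i j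
  proof (cases "i \<in> {1..n} \<and> j \<in> {1..n}")
    case True
    then show ?thesis
      using \<phi>(2)[of i j] by (simp add: w_def edges_def)
  next
    case False
    then have "(i, j) \<notin> edges f" "(w i, w j) \<notin> edges g"
      using edges_sub[OF f] edges_sub[OF g] permutes_in_image[OF w] by blast+
    then show ?thesis by (simp add: edges_def)
  qed
  have "g (w i) = map_option w (f i)" for i
  proof (cases "g (w i)")
    case None
    then show ?thesis using edge[of i] by (cases "f i") auto
  next
    \<comment> \<open>The edge equivalence speaks only of values of the form \<open>w j\<close>;
      surjectivity of \<open>w\<close> supplies \<open>j\<close> as the preimage of
      \<open>b\<close>.\<close>
    case (Some b)
    then show ?thesis
      using edge[of i "inv' w b"] by (simp add: permutes_inverses[OF w])
  qed
  then have "conj_act w f = g"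
    using permutes_bij[OF w] by (intro conj_act_eqI)
  with w show ?thesis by blast
qed

text \<open>Elements of \<open>BijGroup\<close> are extensional functions, hence the restriction to
  the set acted on. Invariance of the shape makes each restricted map a self-map, and conjugation by
  the inverse permutation makes it bijective.\<close>

lemma group_action_conj_act:
  "group_action (sym_group n) (placements_with_shape k n S)
     (\<lambda>w. restrict (conj_act w) (placements_with_shape k n S))"
proof -
  define E where "E = placements_with_shape k n S"
  have closed: "conj_act w f \<in> E" if "w permutes {1..n}" "f \<in> E" for w f
    using conj_act_with_shape that unfolding E_def by blast
  have Bij: "restrict (conj_act w) E \<in> Bij E" if w: "w permutes {1..n}" for w
  proof -
    have "bij_betw (conj_act w) E E"
    proof (rule bij_betw_byWitness[where f' = "conj_act (inv' w)"])
      show "\<forall>f\<in>E. conj_act (inv' w) (conj_act w f) = f" "\<forall>f\<in>E. conj_act w (conj_act (inv' w) f) = f"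
        by (simp_all flip: conj_act_comp
            add: permutes_bij[OF w] permutes_bij[OF permutes_inv[OF w]] permutes_inv_o[OF w] conj_act_id)
    qed (use w closed permutes_inv in blast)+
    then show ?thesis
      by (simp add: Bij_def cong: bij_betw_cong)
  qed
  have "(\<lambda>w. restrict (conj_act w) E) \<in> hom (sym_group n) (BijGroup E)"
  proof (rule homI)
    fix v w assume "v \<in> carrier (sym_group n)" "w \<in> carrier (sym_group n)"
    then have vw: "v permutes {1..n}" "w permutes {1..n}"
      by (simp_all add: sym_group_carrier)
    \<comment> \<open>Multiplication in \<open>BijGroup E\<close> is \<open>compose E\<close>. By
      closure, the inner map stays in \<open>E\<close>, where the outer restriction agrees with
      conjugation.\<close>
    have "restrict (conj_act (v \<circ> w)) E = compose E (restrict (conj_act v) E) (restrict (conj_act w) E)"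
      using vw by (auto simp: compose_def closed conj_act_comp permutes_bij)
    then show "restrict (conj_act (v \<otimes>\<^bsub>sym_group n\<^esub> w)) E =
        restrict (conj_act v) E \<otimes>\<^bsub>BijGroup E\<^esub> restrict (conj_act w) E"
      using vw by (simp add: BijGroup_def Bij sym_group_mult)
  qed (simp add: BijGroup_def Bij sym_group_carrier)
  then show ?thesis
    unfolding E_def group_action_def
    by (simp add: group_hom_def group_hom_axioms_def sym_group_is_group group_BijGroup)
qed

theorem lemma5p1:
  fixes k n :: nat
  shows "(\<forall>f \<in> nilpotent_placements k n. \<forall>i. 1 \<le> i \<and> i < n \<longrightarrow>
            underlying (forest_of n (conj_act (transpose i (i + 1)) f)) = underlying (forest_of n f))
       \<and> (\<forall>S \<in> unlabeled_forests.
            transitive_action (sym_group n) (placements_with_shape k n S)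
              (\<lambda>w. restrict (conj_act w) (placements_with_shape k n S)))"
proof (intro conjI ballI allI impI)
  fix f i assume f: "f \<in> nilpotent_placements k n" and i: "1 \<le> i \<and> i < n"
  have "transpose i (i + 1) permutes {1..n}"
    using i by (intro permutes_swap_id) auto
  then show "underlying (forest_of n (conj_act (transpose i (i + 1)) f)) = underlying (forest_of n f)"
    using f by (rule underlying_conj_act)
next
  fix S
  show "transitive_action (sym_group n) (placements_with_shape k n S)
      (\<lambda>w. restrict (conj_act w) (placements_with_shape k n S))"
  \<comment> \<open>What remains beyond the action is a permutation joining any two members. If no
    placement has shape \<open>S\<close>, this holds vacuously.\<close>
  proof (rule transitive_action.intro[OF group_action_conj_act], unfold_locales)
    fix f g assume f: "f \<in> placements_with_shape k n S" and "g \<in> placements_with_shape k n S"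
    then have "\<exists>w. w permutes {1..n} \<and> conj_act w f = g"
      by (intro ex_conj_act_eq) (auto simp: placements_with_shape_def)
    then show "\<exists>w\<in>carrier (sym_group n). restrict (conj_act w) (placements_with_shape k n S) f = g"
      using f by (auto simp: sym_group_carrier)
  qed
qed

end
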